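(* Let $a \ge 2$, $t\ge 2$ and $n \ge 1$ be integers. For every $t$-wise perfect set $\mathcal{V}$ of vectors of length $n$ over the alphabet $\Sigma_a=\{0,1,\ldots,a-1\}$ there is a family $\mathcal{P}$ of $t$-wise properly overlapping $a$-partitions of $[n]$ of the same size, in one-to-one correspondence with $\mathcal{V}$. Conversely, for every family $\mathcal{P}$ of $t$-wise properly overlapping $a$-partitions of $[n]$ there is a $t$-wise perfect set $\mathcal{V}$ of vectors of length $n$ over $\Sigma_a$ of the same size, in one-to-one correspondence with $\mathcal{P}$.
   Context: $[n]=\{1,2,\ldots,n\}$. For a vector $\mathbf{v}\in\Sigma_a^n$ and $r\in[n]$, $\mathbf{v}[r]$ is its $r$-th coordinate. A set of vectors $\mathcal{V}=\{\mathbf{v}_1,\ldots,\mathbf{v}_k\}\subseteq \Sigma_a^n$ is called $t$-wise perfect with respect to $\Sigma_a$ if (i) $|\mathcal{V}|\ge t$, and (ii) for every $t$-tuple $(\mathbf{v}_{i_1},\ldots,\mathbf{v}_{i_t})$ with $1\le i_1<i_2<\cdots<i_t\le k$ and every string $\alpha\in\Sigma_a^t$, there is some $r\in[n]$ with $\mathbf{v}_{i_1}[r]\cdots\mathbf{v}_{i_t}[r]=\alpha$. An $a$-partition of a set is an unordered partition of it into $a$ parts. A family $\mathcal{P}$ of $a$-partitions of $[n]$ is $t$-wise properly overlapping if (i) $|\mathcal{P}|\ge t$, and (ii) for any subfamily of $t$ (distinct) $a$-partitions $P_1,\ldots,P_t$ in $\mathcal{P}$, the intersection of any $t$ parts, with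 one part taken from each $P_i$, is nonempty. *)

theory Defs
  imports Main "HOL-Library.FuncSet" "HOL-Library.Disjoint_Sets"
begin

text \<open>Vectors of length \<open>n\<close> over the alphabet \<open>{0, ..., a - 1}\<close> are the extensional functions
  on \<open>{1..n}\<close>, so that two vectors are equal iff all their coordinates agree; the coordinate
  \<open>v[r]\<close> is \<open>v r\<close>.\<close>

definition vectors :: "nat \<Rightarrow> nat \<Rightarrow> (nat \<Rightarrow> nat) set" where
  "vectors a n = {1..n} \<rightarrow>\<^sub>E {..<a}"

text \<open>The set is written as \<open>{v 1, ..., v k}\<close> without repetition. Nothing depends on the
  enumeration chosen, since \<open>\<alpha>\<close> ranges over all strings; the definition quantifies over all of
  them (one exists, since \<open>V\<close> is finite).\<close>

definition perfect_vectors :: "nat \<Rightarrow> nat \<Rightarrow> nat \<Rightarrow> (nat \<Rightarrow> nat) set \<Rightarrow> bool" where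
  "perfect_vectors a n t V \<longleftrightarrow>
     V \<subseteq> vectors a n \<and>
     card V \<ge> t \<and>
     (\<forall>v. bij_betw v {1..card V} V \<longrightarrow>
       (\<forall>i \<in> {1..t} \<rightarrow> {1..card V}. strict_mono_on {1..t} i \<longrightarrow>
         (\<forall>\<alpha> \<in> vectors a t. \<exists>r\<in>{1..n}. \<forall>j\<in>{1..t}. v (i j) r = \<alpha> j)))"

text \<open>The parts of a partition are nonempty. Allowing empty parts would not change the next
  notion: as \<open>card \<P> \<ge> t \<ge> 1\<close>, every part takes part in one of the intersections.\<close>

definition a_partition :: "nat \<Rightarrow> nat \<Rightarrow> nat set set \<Rightarrow> bool" where
  "a_partition a n P \<longleftrightarrow> partition_on {1..n} P \<and> card P = a"

definition properly_overlapping :: "nat \<Rightarrow> nat \<Rightarrow> nat \<Rightarrow> nat set set set \<Rightarrow> bool" where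
  "properly_overlapping a n t \<P> \<longleftrightarrow>
     (\<forall>P\<in>\<P>. a_partition a n P) \<and>
     card \<P> \<ge> t \<and>
     (\<forall>\<Q> \<subseteq> \<P>. card \<Q> = t \<longrightarrow>
       (\<forall>c. (\<forall>P\<in>\<Q>. c P \<in> P) \<longrightarrow> (\<Inter>P\<in>\<Q>. c P) \<noteq> {}))"

end

theory Submission
  imports Defs
begin

text \<open>A vector \<open>v\<close> corresponds to the partition of \<open>[n]\<close> into its level sets. A string \<open>\<alpha>\<close> on
  \<open>t\<close> vectors is a choice of one level set for each of them, and the coordinates at which the
  vectors spell \<open>\<alpha>\<close> are the points of the intersection of the chosen level sets. Conversely, a
  numbering of the parts of a partition turns it into a vector with these level sets. Distinct
  vectors \<open>v\<close> and \<open>v'\<close> have distinct partitions: as \<open>t \<ge> 2\<close>, they lie in a common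
  \<open>t\<close>-subset, so the pair \<open>(v, v')\<close> takes both values \<open>(0, 0)\<close> and \<open>(0, 1)\<close>, and a level
  set of \<open>v\<close> is cut by \<open>v'\<close>.\<close>

text \<open>Choosing the enumeration of \<open>V\<close> so that it lists \<open>S\<close> first makes the increasing index
  map the identity.\<close>

lemma perfect_vectors_iff:
  "perfect_vectors a n t V \<longleftrightarrow>
     V \<subseteq> vectors a n \<and> card V \<ge> t \<and>
     (\<forall>S\<subseteq>V. card S = t \<longrightarrow>
       (\<forall>w \<in> S \<rightarrow> {..<a}. \<exists>r\<in>{1..n}. \<forall>v\<in>S. v r = w v))"
proof (cases "V \<subseteq> vectors a n \<and> card V \<ge> t")
  case True
  then have "finite V"
    unfolding vectors_def by (meson finite_PiE finite_atLeastAtMost finite_lessThan finite_subset)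
  have "(\<forall>v. bij_betw v {1..card V} V \<longrightarrow>
       (\<forall>i \<in> {1..t} \<rightarrow> {1..card V}. strict_mono_on {1..t} i \<longrightarrow>
         (\<forall>\<alpha> \<in> vectors a t. \<exists>r\<in>{1..n}. \<forall>j\<in>{1..t}. v (i j) r = \<alpha> j))) \<longleftrightarrow>
     (\<forall>S\<subseteq>V. card S = t \<longrightarrow>
       (\<forall>w \<in> S \<rightarrow> {..<a}. \<exists>r\<in>{1..n}. \<forall>v\<in>S. v r = w v))" (is "?L \<longleftrightarrow> ?R")
  proof
    assume L: ?L
    show ?R
    proof (intro allI impI ballI)
      fix S w assume S: "S \<subseteq> V" "card S = t" and w: "w \<in> S \<rightarrow> {..<a}"
      have fin: "finite S" "finite (V - S)"
        using S \<open>finite V\<close> finite_subset by auto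
      obtain e where e: "bij_betw e {1..t} S"
        using ex_bij_betw_nat_finite_1[OF fin(1)] S by auto
      have "card {t+1..card V} = card (V - S)"
        using S fin by (simp add: card_Diff_subset)
      then obtain e' where e': "bij_betw e' {t+1..card V} (V - S)"
        using fin by (metis finite_atLeastAtMost finite_same_card_bij)
      define v where "v j = (if j \<in> {1..t} then e j else e' j)" for j
      have "bij_betw v ({1..t} \<union> {t+1..card V}) (S \<union> (V - S))"
        unfolding v_def by (rule bij_betw_disjoint_Un[OF e e']) auto
      moreover have "{1..t} \<union> {t+1..card V} = {1..card V}" "S \<union> (V - S) = V"
        using True S by auto
      ultimately have "bij_betw v {1..card V} V"
        by simp
      moreover have "id \<in> {1..t} \<rightarrow> {1..card V}" "strict_mono_on {1..t} (id :: nat \<Rightarrow> nat)"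
        using True by (auto simp: strict_mono_on_def)
      \<comment> \<open>The string is \<open>w\<close> read along the enumeration of
        \<open>S\<close>. It is restricted to \<open>{1..t}\<close> because elements of
        \<open>vectors a t\<close> are extensional.\<close>
      moreover have "(\<lambda>j\<in>{1..t}. w (e j)) \<in> vectors a t"
        using w bij_betwE[OF e] unfolding vectors_def by fastforce
      ultimately obtain r where "r \<in> {1..n}" "\<forall>j\<in>{1..t}. v (id j) r = (\<lambda>j\<in>{1..t}. w (e j)) j"
        using L by blast
      then have "\<forall>j\<in>{1..t}. e j r = w (e j)"
        by (auto simp: v_def)
      then show "\<exists>r\<in>{1..n}. \<forall>v\<in>S. v r = w v"
        using \<open>r \<in> {1..n}\<close> bij_betw_imp_surj_on[OF e] by blast
    qed
  next
    assume R: ?R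
    show ?L
    proof (intro allI impI ballI)
      fix v i \<alpha>
      assume v: "bij_betw v {1..card V} V" and i: "i \<in> {1..t} \<rightarrow> {1..card V}"
        and mono: "strict_mono_on {1..t} i" and \<alpha>: "\<alpha> \<in> vectors a t"
      \<comment> \<open>Increasing indices name distinct vectors. Hence the image has exactly
        \<open>t\<close> elements, and inverting \<open>v \<circ> i\<close> on it carries the string
        \<alpha> over to a function on these vectors.\<close>
      have inj: "inj_on (v \<circ> i) {1..t}"
        using strict_mono_on_imp_inj_on[OF mono] bij_betw_imp_inj_on[OF v] i
        by (auto intro!: comp_inj_on elim: inj_on_subset)
      let ?S = "(v \<circ> i) ` {1..t}"
      let ?w = "\<alpha> \<circ> inv_into {1..t} (v \<circ> i)"
      have "?S \<subseteq> V"
        using bij_betwE[OF v] i by auto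
      moreover have "card ?S = t"
        using card_image[OF inj] by simp
      moreover have "?w \<in> ?S \<rightarrow> {..<a}"
        using \<alpha> inv_into_f_f[OF inj] by (auto simp: vectors_def)
      ultimately obtain r where "r \<in> {1..n}" "\<forall>u\<in>?S. u r = ?w u"
        using R[rule_format, of ?S ?w] by auto
      then show "\<exists>r\<in>{1..n}. \<forall>j\<in>{1..t}. v (i j) r = \<alpha> j"
        using inv_into_f_f[OF inj] by (metis comp_apply imageI)
    qed
  qed
  with True show ?thesis
    unfolding perfect_vectors_def by blast
qed (auto simp: perfect_vectors_def)

text \<open>The index runs over the whole alphabet, not over the range of \<open>v\<close>: a symbol
  that \<open>v\<close> misses contributes the empty set.\<close>

definition level_sets :: "nat \<Rightarrow> nat \<Rightarrow> (nat \<Rightarrow> nat) \<Rightarrow> nat set set" where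
  "level_sets a n v = (\<lambda>s. {r \<in> {1..n}. v r = s}) ` {..<a}"

text \<open>Surjectivity enters twice: it makes every level set nonempty, and it keeps level sets of
  different symbols apart, so that there are exactly \<open>a\<close> of them.\<close>

lemma a_partition_level_sets:
  assumes "v \<in> vectors a n" and surj: "\<And>s. s < a \<Longrightarrow> \<exists>r\<in>{1..n}. v r = s"
  shows "a_partition a n (level_sets a n v)"
proof -
  have "partition_on {1..n} (level_sets a n v)"
    using assms unfolding partition_on_def disjoint_def level_sets_def vectors_def by fastforce
  moreover have "inj_on (\<lambda>s. {r \<in> {1..n}. v r = s}) {..<a}"
  proof (rule inj_onI)
    fix s s' assume s: "s \<in> {..<a}" and eq: "{r \<in> {1..n}. v r = s} = {r \<in> {1..n}. v r = s'}"
    obtain r where "r \<in> {1..n}" "v r = s" using surj[of s] s by auto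
    with eq show "s = s'" by auto
  qed
  ultimately show ?thesis
    unfolding a_partition_def level_sets_def by (simp add: card_image)
qed

lemma a_partition_eq_level_sets:
  assumes "a_partition a n P"
  obtains v where "v \<in> vectors a n" "level_sets a n v = P"
proof -
  have P: "partition_on {1..n} P" "card P = a"
    using assms by (auto simp: a_partition_def)
  have "finite P"
    using P(1) finite_elements by blast
  then obtain b where b: "bij_betw b {..<a} P"
    using P(2) ex_bij_betw_nat_finite[of P] by (auto simp: atLeast0LessThan)
  have "\<exists>s<a. r \<in> b s" if "r \<in> {1..n}" for r
    using that P(1) bij_betw_imp_surj_on[OF b] by (auto simp: partition_on_def)
  then obtain c where c: "\<And>r. r \<in> {1..n} \<Longrightarrow> c r < a \<and> r \<in> b (c r)"
    by metis
  have b_sub: "b s \<subseteq> {1..n}" if "s < a" for s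
    using that P(1) bij_betwE[OF b] by (auto simp: partition_on_def)
  \<comment> \<open>Disjointness of the parts makes \<open>c r\<close> the only number of a part
    containing \<open>r\<close>. Thus each level set of \<open>c\<close> is all of
    \<open>b s\<close> and not merely a subset of it.\<close>
  have uniq: "c r = s" if "s < a" "r \<in> b s" for r s
  proof (rule ccontr)
    assume "c r \<noteq> s"
    have "r \<in> {1..n}" using that b_sub by blast
    with c have "c r < a" "r \<in> b (c r)" by auto
    moreover from this \<open>c r \<noteq> s\<close> \<open>s < a\<close> have "b (c r) \<noteq> b s"
      using bij_betw_imp_inj_on[OF b] by (auto simp: inj_on_def)
    ultimately show False
      using P(1) that bij_betwE[OF b] unfolding partition_on_def disjoint_def by blast
  qed
  define v where "v = restrict c {1..n}"
  have "{r \<in> {1..n}. v r = s} = b s" if "s < a" for s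
    using that uniq c b_sub[OF that] by (auto simp: v_def)
  then have "level_sets a n v = b ` {..<a}"
    unfolding level_sets_def by (intro image_cong) auto
  then have "level_sets a n v = P"
    using bij_betw_imp_surj_on[OF b] by simp
  moreover have "v \<in> vectors a n"
    using c by (auto simp: v_def vectors_def)
  ultimately show ?thesis
    using that by blast
qed

lemma perfect_vectors_imp_properly_overlapping:
  assumes "a \<ge> 2" "t \<ge> 2" and V: "perfect_vectors a n t V"
  shows "inj_on (level_sets a n) V" "properly_overlapping a n t (level_sets a n ` V)"
proof -
  have V_sub: "V \<subseteq> vectors a n" and V_card: "t \<le> card V"
    and perf: "\<And>S w. S \<subseteq> V \<Longrightarrow> card S = t \<Longrightarrow> w \<in> S \<rightarrow> {..<a} \<Longrightarrow> \<exists>r\<in>{1..n}. \<forall>v\<in>S. v r = w v"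
    using V unfolding perfect_vectors_iff by auto
  have "finite V"
    using V_card \<open>t \<ge> 2\<close> by (intro card_ge_0_finite) simp
  \<comment> \<open>The bound on \<open>w\<close> is global because the \<open>t\<close>-subset into
    which the pair is extended is not known beforehand. The case \<open>v = v'\<close> is included
    and later gives surjectivity of a single vector.\<close>
  have pair: "\<exists>r\<in>{1..n}. v r = w v \<and> v' r = w v'"
    if v: "v \<in> V" "v' \<in> V" and w: "\<forall>u. w u < a" for v v' w
  proof -
    have "card {v, v'} \<le> t"
      using \<open>t \<ge> 2\<close> card_insert_le_m1[of t "{v'}" v] by simp
    then obtain S where "{v, v'} \<subseteq> S" "S \<subseteq> V" "card S = t"
      using exists_subset_between[OF _ V_card _ \<open>finite V\<close>, of "{v, v'}"] v by auto
    with perf[of S w] w show ?thesis by auto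
  qed
  show inj: "inj_on (level_sets a n) V"
  proof (rule inj_onI, rule ccontr)
    fix v v' assume v: "v \<in> V" "v' \<in> V" and eq: "level_sets a n v = level_sets a n v'"
      and "v \<noteq> v'"
    obtain r where r: "r \<in> {1..n}" "v r = 0" "v' r = 0"
      using pair[OF v, of "\<lambda>_. 0"] \<open>a \<ge> 2\<close> by auto
    have "\<forall>u. (if u = v then 0 else 1) < a"
      using \<open>a \<ge> 2\<close> by simp
    from pair[OF v this] obtain r' where r': "r' \<in> {1..n}" "v r' = 0" "v' r' = 1"
      using \<open>v \<noteq> v'\<close> by auto
    \<comment> \<open>The zero level set of \<open>v\<close> would be the level set of
      \<open>v'\<close> for some symbol \<open>s\<close>. It contains both \<open>r\<close> and
      \<open>r'\<close>, which forces \<open>0 = s = 1\<close>.\<close>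
    have "{r \<in> {1..n}. v r = 0} \<in> level_sets a n v'"
      unfolding eq[symmetric] unfolding level_sets_def using \<open>a \<ge> 2\<close> by auto
    then obtain s where s: "{r \<in> {1..n}. v r = 0} = {r \<in> {1..n}. v' r = s}"
      by (auto simp: level_sets_def)
    have "r \<in> {r \<in> {1..n}. v' r = s}" "r' \<in> {r \<in> {1..n}. v' r = s}"
      unfolding s[symmetric] using r r' by auto
    with r r' show False by simp
  qed
  show "properly_overlapping a n t (level_sets a n ` V)"
    unfolding properly_overlapping_def
  proof (intro conjI ballI allI impI)
    fix P assume "P \<in> level_sets a n ` V"
    then obtain v where v: "v \<in> V" "P = level_sets a n v" by blast
    have "\<exists>r\<in>{1..n}. v r = s" if "s < a" for s
      using pair[OF v(1) v(1), of "\<lambda>_. s"] that by auto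
    then show "a_partition a n P"
      using a_partition_level_sets v V_sub by blast
  next
    show "t \<le> card (level_sets a n ` V)"
      using V_card card_image[OF inj] by simp
  next
    fix \<Q> c assume "\<Q> \<subseteq> level_sets a n ` V" "card \<Q> = t" and c: "\<forall>P\<in>\<Q>. c P \<in> P"
    then obtain S where S: "S \<subseteq> V" "\<Q> = level_sets a n ` S"
      by (auto simp: subset_image_iff)
    \<comment> \<open>Injectivity is what turns \<open>t\<close> distinct partitions into
      \<open>t\<close> distinct vectors.\<close>
    have "card S = t"
      using S \<open>card \<Q> = t\<close> card_image[OF inj_on_subset[OF inj S(1)]] by simp
    \<comment> \<open>Each chosen part is the level set of some symbol; these symbols form the
      string to be realised.\<close>
    have "\<forall>v\<in>S. \<exists>s<a. c (level_sets a n v) = {r \<in> {1..n}. v r = s}"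
      using c S(2) by (force simp: level_sets_def)
    then obtain w where w: "\<And>v. v \<in> S \<Longrightarrow> w v < a"
      "\<And>v. v \<in> S \<Longrightarrow> c (level_sets a n v) = {r \<in> {1..n}. v r = w v}"
      by metis
    obtain r where "r \<in> {1..n}" "\<forall>v\<in>S. v r = w v"
      using perf[OF S(1) \<open>card S = t\<close>, of w] w(1) by auto
    then have "r \<in> (\<Inter>P\<in>\<Q>. c P)"
      using w(2) S(2) by auto
    then show "(\<Inter>P\<in>\<Q>. c P) \<noteq> {}" by blast
  qed
qed

text \<open>One numbering of the parts is fixed for each partition, giving a right inverse
  \<open>g\<close> of \<open>level_sets a n\<close> on \<open>\<P>\<close>. Such a map is injective,
  since the vector determines its partition.\<close>

lemma properly_overlapping_imp_perfect_vectors: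
  assumes "a \<ge> 2" "t \<ge> 2" and \<P>: "properly_overlapping a n t \<P>"
  obtains g where "inj_on g \<P>" "perfect_vectors a n t (g ` \<P>)"
proof -
  have part: "\<And>P. P \<in> \<P> \<Longrightarrow> a_partition a n P" and \<P>_card: "t \<le> card \<P>"
    and overlap: "\<And>\<Q> c. \<Q> \<subseteq> \<P> \<Longrightarrow> card \<Q> = t \<Longrightarrow> (\<And>P. P \<in> \<Q> \<Longrightarrow> c P \<in> P) \<Longrightarrow> (\<Inter>P\<in>\<Q>. c P) \<noteq> {}"
    using \<P> unfolding properly_overlapping_def by auto
  have "finite \<P>"
    using \<P>_card \<open>t \<ge> 2\<close> by (intro card_ge_0_finite) simp
  have "\<forall>P\<in>\<P>. \<exists>v. v \<in> vectors a n \<and> level_sets a n v = P"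
    using part a_partition_eq_level_sets by metis
  then obtain g where g: "\<And>P. P \<in> \<P> \<Longrightarrow> g P \<in> vectors a n"
    and level: "\<And>P. P \<in> \<P> \<Longrightarrow> level_sets a n (g P) = P"
    by metis
  have inj: "inj_on g \<P>"
    using level by (metis inj_on_inverseI)
  have "perfect_vectors a n t (g ` \<P>)"
    unfolding perfect_vectors_iff
  proof (intro conjI allI impI ballI)
    show "g ` \<P> \<subseteq> vectors a n" using g by blast
    show "t \<le> card (g ` \<P>)" using \<P>_card card_image[OF inj] by simp
  next
    fix S w assume "S \<subseteq> g ` \<P>" "card S = t" and w: "w \<in> S \<rightarrow> {..<a}"
    then obtain \<Q> where \<Q>: "\<Q> \<subseteq> \<P>" "S = g ` \<Q>"
      by (auto simp: subset_image_iff)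
    have "card \<Q> = t"
      using \<Q> \<open>card S = t\<close> card_image[OF inj_on_subset[OF inj \<Q>(1)]] by simp
    define c where "c P = {r \<in> {1..n}. g P r = w (g P)}" for P
    have "c P \<in> P" if "P \<in> \<Q>" for P
    proof -
      have "c P \<in> level_sets a n (g P)"
        using w that \<Q> by (auto simp: c_def level_sets_def)
      then show ?thesis using level that \<Q>(1) by auto
    qed
    then have "(\<Inter>P\<in>\<Q>. c P) \<noteq> {}"
      using overlap[OF \<Q>(1) \<open>card \<Q> = t\<close>] by blast
    \<comment> \<open>An intersection over the empty family would be all of \<open>nat\<close>; one
      member is needed to place the common point in \<open>{1..n}\<close>.\<close>
    moreover have "\<Q> \<noteq> {}"
      using \<open>card \<Q> = t\<close> \<open>t \<ge> 2\<close> by auto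
    ultimately show "\<exists>r\<in>{1..n}. \<forall>v\<in>S. v r = w v"
      unfolding \<Q>(2) c_def by fastforce
  qed
  with inj show ?thesis using that by blast
qed

theorem mainTheorem2:
  fixes a t n :: nat
  assumes "a \<ge> 2" and "t \<ge> 2" and "n \<ge> 1"
  shows "(\<forall>V. perfect_vectors a n t V \<longrightarrow>
            (\<exists>\<P>. properly_overlapping a n t \<P> \<and> card \<P> = card V \<and> (\<exists>f. bij_betw f V \<P>))) \<and>
         (\<forall>\<P>. properly_overlapping a n t \<P> \<longrightarrow>
            (\<exists>V. perfect_vectors a n t V \<and> card V = card \<P> \<and> (\<exists>g. bij_betw g \<P> V)))"
proof (intro conjI allI impI)
  fix V assume "perfect_vectors a n t V"
  with assms show "\<exists>\<P>. properly_overlapping a n t \<P> \<and> card \<P> = card V \<and> (\<exists>f. bij_betw f V \<P>)"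
    by (meson perfect_vectors_imp_properly_overlapping card_image inj_on_imp_bij_betw)
next
  fix \<P> assume "properly_overlapping a n t \<P>"
  with assms show "\<exists>V. perfect_vectors a n t V \<and> card V = card \<P> \<and> (\<exists>g. bij_betw g \<P> V)"
    by (meson properly_overlapping_imp_perfect_vectors card_image inj_on_imp_bij_betw)
qed

end
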